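(* Let $G$ be a topological gyrogroup with an $\omega^{\omega}$-base $\mathcal{U}=\{U_{\alpha}:\alpha\in\mathbb{N}^{\mathbb{N}}\}$. For $\alpha=(\alpha_i)_{i\in\mathbb{N}}\in\mathbb{N}^{\mathbb{N}}$ and $k\in\mathbb{N}$ put $D_k(\alpha)=\bigcap_{\beta\in I_k(\alpha)}U_\beta$, where $I_k(\alpha)=\{\beta\in\mathbb{N}^{\mathbb{N}}:\beta_i=\alpha_i\text{ for }i=1,\dots,k\}$. If $G$ is sequential, then the set $\bigcup_{k\in\mathbb{N}}D_k(\alpha)$ is an open neighborhood of the identity element $0$ for any $\alpha\in\mathbb{N}^{\mathbb{N}}$.
   Context: $\mathbb{N}$ is the set of positive integers. All topological spaces are assumed Hausdorff. A gyrogroup is a set $G$ with a binary operation $\oplus$ such that: (G1) there is a unique identity element $0\in G$ with $0\oplus a=a=a\oplus 0$ for all $a\in G$; (G2) for each $x\in G$ there is a unique inverse $\ominus x\in G$ with $\ominus x\oplus x=0=x\oplus(\ominus x)$; (G3) for all $x,y\in G$ there is an automorphism $\mathrm{gyr}[x,y]$ of $(G,\oplus)$ with $x\oplus(y\oplus z)=(x\oplus y)\oplus\mathrm{gyr}[x,y](z)$ for all $z\in G$; (G4) $\mathrm{gyr}[x\oplus y,y]=\mathrm{gyr}[x,y]$ for all $x,y\in G$. A topological gyrogroup is a gyrogroup with a topology for which $\oplus:G\times G\to G$ is jointly continuous (with the product topology on $G\times G$) and $x\mapsto\ominus x$ is continuous. $\mathbb{N}^{\mathbb{N}}$, the set of all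 functions from $\mathbb{N}$ to $\mathbb{N}$, carries the pointwise partial order: $\alpha\le\beta$ if and only if $\alpha_i\le\beta_i$ for all $i\in\mathbb{N}$. An $\omega^{\omega}$-base of a topological gyrogroup $G$ is a family $\{U_\alpha:\alpha\in\mathbb{N}^{\mathbb{N}}\}$ of neighborhoods of the identity element $0$ that is a base of neighborhoods at $0$ and satisfies $U_\beta\subset U_\alpha$ whenever $\alpha\le\beta$. A subset $A$ of a space is sequentially open if every sequence converging to a point of $A$ is eventually in $A$; a space is sequential if every sequentially open subset is open.
   Formalization: The neighborhoods U_α of the ω^ω-base are taken to be open sets; for arbitrary neighborhoods the claim fails, e.g. in the real line with U_α = [-1/α_1, 1/α_1], where the union of the D_k(α) is a closed interval and not open. *)

theory Defs
  imports "HOL-Analysis.Analysis"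
begin

text \<open>
  The inverse is required to be the only two-sided inverse. In the gyration law,
  \<open>gyr x y\<close> only matters on the carrier \<open>G\<close>.
\<close>

locale gyrogroup =
  fixes G :: "'a set"
    and op :: "'a \<Rightarrow> 'a \<Rightarrow> 'a" (infixl "\<oplus>" 65)
    and zero :: 'a ("\<zero>")
    and neg :: "'a \<Rightarrow> 'a" ("\<ominus> _" [81] 80)
    and gyr :: "'a \<Rightarrow> 'a \<Rightarrow> 'a \<Rightarrow> 'a"
  assumes closed: "\<lbrakk>x \<in> G; y \<in> G\<rbrakk> \<Longrightarrow> x \<oplus> y \<in> G"
    and zero_closed: "\<zero> \<in> G"
    and zero_left: "a \<in> G \<Longrightarrow> \<zero> \<oplus> a = a"
    and zero_right: "a \<in> G \<Longrightarrow> a \<oplus> \<zero> = a"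
    and zero_unique: "\<lbrakk>e \<in> G; \<forall>a\<in>G. e \<oplus> a = a \<and> a \<oplus> e = a\<rbrakk> \<Longrightarrow> e = \<zero>"
    and neg_closed: "x \<in> G \<Longrightarrow> \<ominus> x \<in> G"
    and neg_left: "x \<in> G \<Longrightarrow> \<ominus> x \<oplus> x = \<zero>"
    and neg_right: "x \<in> G \<Longrightarrow> x \<oplus> \<ominus> x = \<zero>"
    and neg_unique: "\<lbrakk>x \<in> G; y \<in> G; y \<oplus> x = \<zero>; x \<oplus> y = \<zero>\<rbrakk> \<Longrightarrow> y = \<ominus> x"
    and gyr_bij: "\<lbrakk>x \<in> G; y \<in> G\<rbrakk> \<Longrightarrow> bij_betw (gyr x y) G G"
    and gyr_hom: "\<lbrakk>x \<in> G; y \<in> G; a \<in> G; b \<in> G\<rbrakk> \<Longrightarrow>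
          gyr x y (a \<oplus> b) = gyr x y a \<oplus> gyr x y b"
    and gyr_assoc: "\<lbrakk>x \<in> G; y \<in> G; z \<in> G\<rbrakk> \<Longrightarrow>
          x \<oplus> (y \<oplus> z) = (x \<oplus> y) \<oplus> gyr x y z"
    and gyr_loop: "\<lbrakk>x \<in> G; y \<in> G; z \<in> G\<rbrakk> \<Longrightarrow> gyr (x \<oplus> y) y z = gyr x y z"

locale topological_gyrogroup =
  gyrogroup "topspace T" op zero neg gyr
  for T :: "'a topology"
    and op :: "'a \<Rightarrow> 'a \<Rightarrow> 'a" (infixl "\<oplus>" 65)
    and zero :: 'a ("\<zero>")
    and neg :: "'a \<Rightarrow> 'a" ("\<ominus> _" [81] 80)
    and gyr :: "'a \<Rightarrow> 'a \<Rightarrow> 'a \<Rightarrow> 'a" +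
  assumes Hausdorff: "Hausdorff_space T"
    and continuous_op: "continuous_map (prod_topology T T) T (\<lambda>(x, y). x \<oplus> y)"
    and continuous_neg: "continuous_map T T (\<lambda>x. \<ominus> x)"

text \<open>
  The natural numbers start at 1 here, both as indices and as values. A function from
  positive integers to positive integers is represented by the extensional function that
  is \<open>undefined\<close> at 0, so the order only looks at positive indices.
\<close>

definition pos_seqs :: "(nat \<Rightarrow> nat) set" where
  "pos_seqs = {1..} \<rightarrow>\<^sub>E {1..}"

definition seq_le :: "(nat \<Rightarrow> nat) \<Rightarrow> (nat \<Rightarrow> nat) \<Rightarrow> bool" where
  "seq_le \<alpha> \<beta> \<longleftrightarrow> (\<forall>i\<ge>1. \<alpha> i \<le> \<beta> i)"

text \<open>
  A neighborhood of a point means an open set containing it (Engelking's convention).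
  With arbitrary neighborhoods, the sets \<open>{-1/\<alpha> 1..1/\<alpha> 1}\<close> would be an
  \<open>\<omega>\<^sup>\<omega>\<close>-base of the real line for which the unions of the sets \<open>D_set\<close> below
  are these closed intervals, hence not open.
\<close>

definition omega_omega_base :: "'a topology \<Rightarrow> 'a \<Rightarrow> ((nat \<Rightarrow> nat) \<Rightarrow> 'a set) \<Rightarrow> bool" where
  "omega_omega_base T e U \<longleftrightarrow>
     (\<forall>\<alpha>\<in>pos_seqs. openin T (U \<alpha>) \<and> e \<in> U \<alpha>) \<and>
     (\<forall>V. openin T V \<and> e \<in> V \<longrightarrow> (\<exists>\<alpha>\<in>pos_seqs. U \<alpha> \<subseteq> V)) \<and>
     (\<forall>\<alpha>\<in>pos_seqs. \<forall>\<beta>\<in>pos_seqs. seq_le \<alpha> \<beta> \<longrightarrow> U \<beta> \<subseteq> U \<alpha>)"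

definition I_set :: "nat \<Rightarrow> (nat \<Rightarrow> nat) \<Rightarrow> (nat \<Rightarrow> nat) set" where
  "I_set k \<alpha> = {\<beta> \<in> pos_seqs. \<forall>i\<in>{1..k}. \<beta> i = \<alpha> i}"

definition D_set :: "((nat \<Rightarrow> nat) \<Rightarrow> 'a set) \<Rightarrow> nat \<Rightarrow> (nat \<Rightarrow> nat) \<Rightarrow> 'a set" where
  "D_set U k \<alpha> = (\<Inter>\<beta>\<in>I_set k \<alpha>. U \<beta>)"

definition sequentially_openin :: "'a topology \<Rightarrow> 'a set \<Rightarrow> bool" where
  "sequentially_openin T A \<longleftrightarrow> A \<subseteq> topspace T \<and>
     (\<forall>\<sigma> x. range \<sigma> \<subseteq> topspace T \<and> x \<in> A \<and> limitin T \<sigma> x sequentially \<longrightarrow>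
        (\<forall>\<^sub>F n in sequentially. \<sigma> n \<in> A))"

definition sequential_space :: "'a topology \<Rightarrow> bool" where
  "sequential_space T \<longleftrightarrow> (\<forall>A. sequentially_openin T A \<longrightarrow> openin T A)"

end

theory Submission
  imports Defs
begin

text \<open>
  The union \<open>A\<close> of the sets \<open>D_set U k \<alpha>\<close> is sequentially open. Suppose that
  a sequence tends to a point \<open>x \<in> D_set U m \<alpha>\<close> but leaves \<open>A\<close>
  infinitely often. For every \<open>k\<close>, some late term of the sequence misses \<open>U (\<beta> k)\<close>
  for an index \<open>\<beta> k\<close> that agrees with \<open>\<alpha>\<close> on the first \<open>m + k\<close>
  coordinates. At each coordinate all but finitely many of the \<open>\<beta> k\<close> have the value of
  \<open>\<alpha>\<close>, so the \<open>\<beta> k\<close> have a common upper bound \<open>\<gamma>\<close>, and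
  \<open>\<gamma>\<close> still agrees with \<open>\<alpha>\<close> on the first \<open>m\<close> coordinates
  (\<open>I_set_upper_bound\<close>). Hence \<open>U \<gamma>\<close> is an open set that contains \<open>x\<close>,
  and by antitonicity the sequence leaves it infinitely often, which is absurd.
\<close>

text \<open>
  The sequence \<open>\<beta>\<close> converges to \<open>\<alpha>\<close> in the product of discrete spaces.
  The \<open>i\<close>-th coordinates of \<open>\<beta> i, \<beta> (i + 1), \<dots>\<close> are all
  \<open>\<alpha> i\<close>, so the maximum over \<open>k \<le> i\<close> is the supremum over all
  \<open>k\<close>.
\<close>

lemma I_set_upper_bound:
  assumes \<beta>: "\<And>k. \<beta> k \<in> I_set (m + k) \<alpha>"
  obtains \<gamma> where "\<gamma> \<in> I_set m \<alpha>" "\<And>k. seq_le (\<beta> k) \<gamma>"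
proof
  define \<gamma> where "\<gamma> = (\<lambda>i. if i \<ge> 1 then Max ((\<lambda>k. \<beta> k i) ` {..i}) else undefined)"
  have pos: "\<beta> k i \<ge> 1" if "i \<ge> 1" for k i
    using \<beta>[of k] that by (auto simp: I_set_def pos_seqs_def PiE_iff)
  have agree: "\<beta> k i = \<alpha> i" if "1 \<le> i" "i \<le> m + k" for k i
    using \<beta>[of k] that by (auto simp: I_set_def)
  have upper: "\<beta> k i \<le> \<gamma> i" if "i \<ge> 1" for k i
  proof (cases "k \<le> i")
    case True
    then show ?thesis using that by (simp add: \<gamma>_def)
  next
    case False
    then have "\<beta> k i = \<beta> i i" using that by (simp add: agree)
    then show ?thesis using that by (simp add: \<gamma>_def)
  qed
  show "seq_le (\<beta> k) \<gamma>" for k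
    using upper by (simp add: seq_le_def)
  have "\<gamma> i \<ge> 1" if "i \<ge> 1" for i
    using pos[OF that] upper[OF that] by (rule order_trans)
  then have "\<gamma> \<in> pos_seqs"
    by (auto simp: pos_seqs_def PiE_iff extensional_def \<gamma>_def)
  moreover have "\<gamma> i = \<alpha> i" if "i \<in> {1..m}" for i
  proof -
    have "(\<lambda>k. \<beta> k i) ` {..i} = {\<alpha> i}"
      using that by (auto simp: agree)
    then show ?thesis using that by (simp add: \<gamma>_def)
  qed
  ultimately show "\<gamma> \<in> I_set m \<alpha>"
    by (simp add: I_set_def)
qed

lemma sequentially_openin_Union_D_set:
  assumes opn: "\<And>\<beta>. \<beta> \<in> pos_seqs \<Longrightarrow> openin T (U \<beta>)"
    and anti: "\<And>\<beta> \<gamma>. \<lbrakk>\<beta> \<in> pos_seqs; \<gamma> \<in> pos_seqs; seq_le \<beta> \<gamma>\<rbrakk> \<Longrightarrow> U \<gamma> \<subseteq> U \<beta>"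
    and \<alpha>: "\<alpha> \<in> pos_seqs"
  shows "sequentially_openin T (\<Union>k\<in>{1..}. D_set U k \<alpha>)"
    (is "sequentially_openin T ?A")
  unfolding sequentially_openin_def
proof (intro conjI allI impI)
  have "D_set U k \<alpha> \<subseteq> U \<alpha>" for k
    using \<alpha> by (auto simp: D_set_def I_set_def)
  then show "?A \<subseteq> topspace T"
    using openin_subset[OF opn[OF \<alpha>]] by blast
next
  fix \<sigma> x
  assume "range \<sigma> \<subseteq> topspace T \<and> x \<in> ?A \<and> limitin T \<sigma> x sequentially"
  then obtain m where m: "m \<ge> 1" "x \<in> D_set U m \<alpha>" and lim: "limitin T \<sigma> x sequentially"
    by auto
  show "\<forall>\<^sub>F n in sequentially. \<sigma> n \<in> ?A"
  proof (rule ccontr)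
    assume "\<not> (\<forall>\<^sub>F n in sequentially. \<sigma> n \<in> ?A)"
    then have "\<exists>n\<ge>k. \<sigma> n \<notin> ?A" for k
      by (auto simp: eventually_sequentially)
    then have "\<exists>n\<ge>k. \<sigma> n \<notin> D_set U (m + k) \<alpha>" for k
      using m(1) by (metis UN_I atLeast_iff trans_le_add1)
    then have "\<exists>n \<beta>. n \<ge> k \<and> \<beta> \<in> I_set (m + k) \<alpha> \<and> \<sigma> n \<notin> U \<beta>" for k
      by (fastforce simp: D_set_def)
    then obtain n \<beta> where n: "\<And>k. n k \<ge> k"
      and \<beta>: "\<And>k. \<beta> k \<in> I_set (m + k) \<alpha>" and miss: "\<And>k. \<sigma> (n k) \<notin> U (\<beta> k)"
      by metis
    obtain \<gamma> where \<gamma>: "\<gamma> \<in> I_set m \<alpha>" and upper: "\<And>k. seq_le (\<beta> k) \<gamma>"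
      using I_set_upper_bound[OF \<beta>] by blast
    have \<gamma>_pos: "\<gamma> \<in> pos_seqs" and \<beta>_pos: "\<And>k. \<beta> k \<in> pos_seqs"
      using \<gamma> \<beta> by (auto simp: I_set_def)
    have "x \<in> U \<gamma>"
      using m(2) \<gamma> by (auto simp: D_set_def)
    then obtain N where "\<And>k. k \<ge> N \<Longrightarrow> \<sigma> k \<in> U \<gamma>"
      using lim opn[OF \<gamma>_pos] by (auto simp: limitin_sequentially)
    then have "\<sigma> (n N) \<in> U (\<beta> N)"
      using n[of N] anti[OF \<beta>_pos \<gamma>_pos upper] by blast
    then show False
      using miss by blast
  qed
qed

theorem lemma3p4:
  fixes T :: "'a topology"
    and op :: "'a \<Rightarrow> 'a \<Rightarrow> 'a"
    and zero :: 'a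
    and neg :: "'a \<Rightarrow> 'a"
    and gyr :: "'a \<Rightarrow> 'a \<Rightarrow> 'a \<Rightarrow> 'a"
    and U :: "(nat \<Rightarrow> nat) \<Rightarrow> 'a set"
    and \<alpha> :: "nat \<Rightarrow> nat"
  assumes "topological_gyrogroup T op zero neg gyr"
    and "omega_omega_base T zero U"
    and "sequential_space T"
    and "\<alpha> \<in> pos_seqs"
  shows "openin T (\<Union>k\<in>{1..}. D_set U k \<alpha>) \<and> zero \<in> (\<Union>k\<in>{1..}. D_set U k \<alpha>)"
proof
  have "sequentially_openin T (\<Union>k\<in>{1..}. D_set U k \<alpha>)"
    using assms(2,4)
    by (intro sequentially_openin_Union_D_set) (auto simp: omega_omega_base_def)
  then show "openin T (\<Union>k\<in>{1..}. D_set U k \<alpha>)"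
    using assms(3) by (simp add: sequential_space_def)
  have "zero \<in> D_set U 1 \<alpha>"
    using assms(2) by (auto simp: D_set_def I_set_def omega_omega_base_def)
  then show "zero \<in> (\<Union>k\<in>{1..}. D_set U k \<alpha>)"
    by auto
qed

end
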